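(* Let $r\ge 1$ be an integer and $T$ a (finite) tree. Let $T[r]$ be the graph obtained from $T$ by replacing every vertex by an independent set of $r$ vertices, where copies of two vertices are adjacent if and only if the original vertices are adjacent in $T$. Then there is a constant $C$ depending only on $T$ and $r$ such that $\mathrm{ex}(n,T[r])\le C n^{2-\frac{1}{r}}$ for all $n$.
   Context: For a graph $F$, $\mathrm{ex}(n,F)$ denotes the maximum number of edges in a simple graph on $n$ vertices that does not contain $F$ as a subgraph. *)

theory Defs
  imports Complex_Main "Graph_Theory.Graph_Theory"
begin

text \<open>
  Finite simple graphs are the AFP's \<^const>\<open>pair_graph\<close>s: finite, loop-free, symmetric arc
  relations, so every undirected edge $uv$ is present as the two arcs $(u,v)$ and $(v,u)$.
\<close>

definition uedges :: "'a pair_pre_digraph \<Rightarrow> 'a set set" where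
  "uedges G = (\<lambda>(u, v). {u, v}) ` parcs G"

text \<open>
  The library's \<^const>\<open>tree\<close> cannot be used: it counts the walk $u, v, u$ along a single
  undirected edge as a cycle. A cycle of a simple graph is a directed cycle of length at least 3.
  The library's notion of connectedness excludes the null graph.
\<close>

definition undirected_tree :: "'a pair_pre_digraph \<Rightarrow> bool" where
  "undirected_tree T \<longleftrightarrow> pair_graph T \<and> Digraph_Component.connected (with_proj T) \<and>
     \<not> (\<exists>p. pre_digraph.cycle (with_proj T) p \<and> 3 \<le> length p)"

definition blowup :: "'a pair_pre_digraph \<Rightarrow> nat \<Rightarrow> ('a \<times> nat) pair_pre_digraph" where
  "blowup T r = \<lparr> pverts = pverts T \<times> {..<r},
     parcs = {((u, i), (v, j)) | u i v j. (u, v) \<in> parcs T \<and> i < r \<and> j < r} \<rparr>"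

definition contains_copy :: "'b pair_pre_digraph \<Rightarrow> 'a pair_pre_digraph \<Rightarrow> bool" where
  "contains_copy G F \<longleftrightarrow>
     (\<exists>H. subgraph H (with_proj G) \<and> digraph_iso (with_proj F) H)"

text \<open>
  Every graph on $n$ vertices has an isomorphic copy with vertices in \<^typ>\<open>nat\<close>. The edge counts
  below form a finite set, so the supremum is their maximum whenever there is some $F$-free graph on
  $n$ vertices; otherwise (which happens exactly if $F$ is edgeless with at most $n$ vertices) the
  supremum in \<^typ>\<open>nat\<close> is $0$, whereas \<^const>\<open>Max\<close> would be unspecified.
\<close>

definition ex_number :: "nat \<Rightarrow> 'a pair_pre_digraph \<Rightarrow> nat" where
  "ex_number n F = Sup {card (uedges G) | G :: nat pair_pre_digraph.
     pair_graph G \<and> card (pverts G) = n \<and> \<not> contains_copy G F}"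

lemma contains_copy_iff:
  assumes "pair_graph F" "pair_graph G"
  shows "contains_copy G F \<longleftrightarrow>
    (\<exists>f. inj_on f (pverts F) \<and> f ` pverts F \<subseteq> pverts G \<and>
         (\<forall>(u, v) \<in> parcs F. (f u, f v) \<in> parcs G))"
proof
  assume "contains_copy G F"
  then obtain H h where H: "subgraph H (with_proj G)"
    and h: "pre_digraph.digraph_isomorphism (with_proj F) h" "H = app_iso h (with_proj F)"
    by (auto simp: contains_copy_def digraph_iso_def)
  have inj: "inj_on (iso_verts h) (pverts F)"
    and arcs: "\<And>a. a \<in> parcs F \<Longrightarrow> iso_verts h (fst a) = iso_tail h (iso_arcs h a) \<and>
      iso_verts h (snd a) = iso_head h (iso_arcs h a)"
    using h(1) by (auto simp: pre_digraph.digraph_isomorphism_def)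
  have tl: "iso_tail h = fst" "iso_head h = snd"
    using H h(2) by (auto simp: subgraph_def compatible_def app_iso_def)
  have sub: "iso_verts h ` pverts F \<subseteq> pverts G" "iso_arcs h ` parcs F \<subseteq> parcs G"
    using H h(2) by (auto simp: subgraph_def app_iso_def)
  have "(iso_verts h u, iso_verts h v) \<in> parcs G" if "(u, v) \<in> parcs F" for u v
  proof -
    have "iso_arcs h (u, v) = (iso_verts h u, iso_verts h v)"
      using arcs[OF that] tl by (simp add: prod_eq_iff)
    then show ?thesis using sub(2) that by force
  qed
  with inj sub(1) show "\<exists>f. inj_on f (pverts F) \<and> f ` pverts F \<subseteq> pverts G \<and>
         (\<forall>(u, v) \<in> parcs F. (f u, f v) \<in> parcs G)"
    by blast
next
  assume "\<exists>f. inj_on f (pverts F) \<and> f ` pverts F \<subseteq> pverts G \<and>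
         (\<forall>(u, v) \<in> parcs F. (f u, f v) \<in> parcs G)"
  then obtain f where f: "inj_on f (pverts F)" "f ` pverts F \<subseteq> pverts G"
    and "\<forall>(u, v) \<in> parcs F. (f u, f v) \<in> parcs G" by (elim exE conjE) rule
  then have arc: "(f u, f v) \<in> parcs G" if "(u, v) \<in> parcs F" for u v
    using that by auto
  interpret F: pair_graph F by fact
  interpret G: pair_graph G by fact
  define h where "h = \<lparr> iso_verts = f, iso_arcs = map_prod f f, iso_head = snd, iso_tail = fst \<rparr>"
  have "inj_on (map_prod f f) (parcs F)"
    using map_prod_inj_on[OF f(1) f(1)] by (rule inj_on_subset) (auto dest: F.wellformed')
  then have "pre_digraph.digraph_isomorphism (with_proj F) h"
    using f(1) F.wf_digraph by (auto simp: pre_digraph.digraph_isomorphism_def h_def)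
  moreover have "wf_digraph (app_iso h (with_proj F))"
    by unfold_locales (auto simp: app_iso_def h_def dest: F.wellformed')
  then have "subgraph (app_iso h (with_proj F)) (with_proj G)"
    using f arc G.wf_digraph
    by (auto simp: subgraph_def compatible_def app_iso_def h_def)
  ultimately show "contains_copy G F"
    by (auto simp: contains_copy_def digraph_iso_def)
qed

lemma pair_graph_blowup:
  assumes "pair_graph T"
  shows "pair_graph (blowup T r)"
proof -
  interpret T: pair_graph T by fact
  have sub: "parcs (blowup T r) \<subseteq> pverts (blowup T r) \<times> pverts (blowup T r)"
    by (auto simp: blowup_def dest: T.wellformed')
  have fin: "finite (pverts (blowup T r))"
    by (simp add: blowup_def T.pair_finite_verts)
  have sym: "sym (parcs (blowup T r))"
    using T.pair_sym_arcs unfolding symmetric_def sym_def with_proj_simps blowup_def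
    by auto
  show ?thesis
  proof unfold_locales
    show "finite (parcs (blowup T r))"
      using sub fin by (meson finite_SigmaI finite_subset)
    show "fst e \<noteq> snd e" if "e \<in> parcs (blowup T r)" for e
      using that by (auto simp: blowup_def dest: T.pair_no_loops)
  qed (use sub fin sym in \<open>auto simp: symmetric_def subset_iff\<close>)
qed

lemma card_uedges_le:
  assumes "pair_graph G"
  shows "card (uedges G) \<le> card (pverts G) ^ 2"
proof -
  interpret G: pair_graph G by fact
  have "card (uedges G) \<le> card (parcs G)"
    unfolding uedges_def by (rule card_image_le) (rule G.pair_finite_arcs)
  also have "\<dots> \<le> card (pverts G \<times> pverts G)"
    by (rule card_mono) (auto simp: G.pair_finite_verts dest: G.wellformed')
  finally show ?thesis by (simp add: card_cartesian_product power2_eq_square)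
qed

lemma finite_free_edge_counts:
  "finite {card (uedges G) | G :: nat pair_pre_digraph.
     pair_graph G \<and> card (pverts G) = n \<and> \<not> contains_copy G F}"
  by (rule finite_subset[of _ "{..n ^ 2}"]) (auto dest: card_uedges_le)

lemma ex_number_eq_Max:
  assumes "pair_graph (G :: nat pair_pre_digraph)" "card (pverts G) = n" "\<not> contains_copy G F"
  shows "ex_number n F = Max {card (uedges G) | G :: nat pair_pre_digraph.
     pair_graph G \<and> card (pverts G) = n \<and> \<not> contains_copy G F}"
  unfolding ex_number_def
  by (rule cSup_eq_Max) (use assms in \<open>auto intro: finite_free_edge_counts\<close>)

end

theory Submission
  imports Defs "HOL-Library.FuncSet"
begin

text \<open>
  Call two $r$-tuples $x, y$ of vertices of $G$ adjacent if every $x_i$ is adjacent to every $y_j$;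
  a copy of $T[r]$ is then a homomorphism from $T$ to this auxiliary graph whose images are
  injective tuples with pairwise disjoint ranges. A tuple $x$ with $d(x)$ common neighbours has
  $d(x)^r$ neighbours, of which at most $M d(x)^{r-1}$ are non-injective or meet a given set of
  at most $r |T|$ vertices, where $M$ depends only on $r$ and $|T|$. If $G$ has many edges, then by
  convexity $\sum_x d(x) = \sum_v \deg(v)^r > 2 M n^r$, hence also
  $\sum_x d(x)^r > 2 \sum_x M d(x)^{r-1}$. Repeatedly deleting tuples $x$ with at most
  $M d(x)^{r-1}$ remaining neighbours therefore cannot delete everything, and in what remains
  $T$ can be embedded greedily, leaf by leaf.
\<close>

section \<open>Pruning to large minimum degree\<close>

text \<open>Deleting an \<open>x\<close> with at most \<open>c x\<close> neighbours lowers the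
  degree sum by at most \<open>2 * c x\<close>: once for its own degree and once, by symmetry, for
  its share in the degrees of others. The other side drops by exactly \<open>2 * c x\<close>, so the
  strict inequality survives; as it fails for the empty set, deletion stops at a nonempty
  set.\<close>

lemma exists_subset_large_degrees:
  fixes c :: "'b \<Rightarrow> nat"
  assumes "finite X" and "symp R"
    and "2 * sum c X < (\<Sum>x\<in>X. card {y \<in> X. R x y})"
  shows "\<exists>Y \<subseteq> X. Y \<noteq> {} \<and> (\<forall>x\<in>Y. c x < card {y \<in> Y. R x y})"
  using assms(1,3)
proof (induction X rule: finite_psubset_induct)
  case (psubset X)
  show ?case
  proof (cases "\<forall>x\<in>X. c x < card {y \<in> X. R x y}")
    case True
    then show ?thesis using psubset.prems by (intro exI[of _ X]) auto
  next
    case False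
    then obtain x where x: "x \<in> X" "card {y \<in> X. R x y} \<le> c x"
      by (meson not_le)
    define X' where "X' = X - {x}"
    have fin: "finite X'" and X: "X = insert x X'" "x \<notin> X'"
      using psubset.hyps x by (auto simp: X'_def)
    have le: "card {z \<in> X. R y z} \<le> card {z \<in> X'. R y z} + (if R y x then 1 else 0)" for y
    proof -
      have "{z \<in> X. R y z} = {z \<in> X'. R y z} \<union> (if R y x then {x} else {})"
        using X by auto
      then have "card {z \<in> X. R y z} \<le> card {z \<in> X'. R y z} + card (if R y x then {x} else {})"
        by (simp only: card_Un_le)
      then show ?thesis by (cases "R y x") simp_all
    qed
    have "(\<Sum>y\<in>X'. if R y x then 1 else 0::nat) = card {y \<in> X'. R y x}"
      using sum.inter_filter[OF fin, of "\<lambda>_. 1 :: nat" "\<lambda>y. R y x"] by simp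
    also have "\<dots> \<le> card {y \<in> X. R x y}"
      by (rule card_mono) (use psubset.hyps X assms(2) in \<open>auto dest: sympD\<close>)
    finally have ind: "(\<Sum>y\<in>X'. if R y x then 1 else 0::nat) \<le> c x" using x by simp
    have "(\<Sum>y\<in>X. card {z \<in> X. R y z}) = card {z \<in> X. R x z} + (\<Sum>y\<in>X'. card {z \<in> X. R y z})"
      using X fin by simp
    also have "(\<Sum>y\<in>X'. card {z \<in> X. R y z})
        \<le> (\<Sum>y\<in>X'. card {z \<in> X'. R y z} + (if R y x then 1 else 0))"
      by (rule sum_mono) (rule le)
    finally have "(\<Sum>y\<in>X. card {z \<in> X. R y z}) \<le> c x + (\<Sum>y\<in>X'. card {z \<in> X'. R y z}) + c x"
      using x ind by (simp add: sum.distrib)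
    moreover have "sum c X = c x + sum c X'" using X fin by simp
    ultimately have less: "2 * sum c X' < (\<Sum>y\<in>X'. card {z \<in> X'. R y z})"
      using psubset.prems by simp
    have sub: "X' \<subset> X" using x by (auto simp: X'_def)
    from psubset.IH[OF sub less] obtain Y
      where "Y \<subseteq> X'" "Y \<noteq> {} \<and> (\<forall>x\<in>Y. c x < card {y \<in> Y. R x y})"
      by (elim exE conjE) simp
    then show ?thesis using sub by (intro exI[of _ Y]) auto
  qed
qed

section \<open>Counting degenerate tuples\<close>

text \<open>Dropping coordinate \<open>i\<close> is injective on \<open>Q\<close>, since its value
  can be recovered from the rest; this saves one factor \<open>card N\<close>.\<close>

lemma card_PiE_determined_le:
  assumes "finite I" "finite N" "i \<in> I" "Q \<subseteq> I \<rightarrow>\<^sub>E N"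
    and det: "\<And>y. y \<in> Q \<Longrightarrow> y i = g (restrict y (I - {i}))"
  shows "card Q \<le> card N ^ (card I - 1)"
proof -
  have "inj_on (\<lambda>y. restrict y (I - {i})) Q"
  proof (rule inj_onI)
    fix y z assume yz: "y \<in> Q" "z \<in> Q" and eq: "restrict y (I - {i}) = restrict z (I - {i})"
    show "y = z"
    proof (rule PiE_ext)
      show "y \<in> I \<rightarrow>\<^sub>E N" "z \<in> I \<rightarrow>\<^sub>E N" using yz assms by auto
      fix j assume "j \<in> I"
      moreover have "restrict y (I - {i}) j = restrict z (I - {i}) j" by (simp add: eq)
      moreover have "y i = z i" using det[OF yz(1)] det[OF yz(2)] by (simp add: eq)
      ultimately show "y j = z j" by (cases "j = i") auto
    qed
  qed
  then have "card Q = card ((\<lambda>y. restrict y (I - {i})) ` Q)" by (simp add: card_image)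
  also have "\<dots> \<le> card ((I - {i}) \<rightarrow>\<^sub>E N)"
  proof (rule card_mono)
    show "(\<lambda>y. restrict y (I - {i})) ` Q \<subseteq> (I - {i}) \<rightarrow>\<^sub>E N"
    proof (rule image_subsetI)
      fix y assume "y \<in> Q"
      then have "y \<in> I \<rightarrow>\<^sub>E N" using assms(4) by blast
      then show "restrict y (I - {i}) \<in> (I - {i}) \<rightarrow>\<^sub>E N"
        unfolding restrict_PiE_iff by auto
    qed
  qed (use assms in \<open>simp add: finite_PiE\<close>)
  finally show ?thesis using assms by (simp add: card_PiE)
qed

text \<open>Union bound: a bad tuple has an entry \<open>y i\<close> that lies in \<open>B\<close>
  or equals another entry \<open>y j\<close>. For each of the \<open>r\<close> indices
  \<open>i\<close> these are at most \<open>card B + r\<close> conditions, each determining one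
  coordinate from the others.\<close>

lemma card_PiE_noninj_or_hitting_le:
  assumes "finite N" "finite B"
  shows "card {y \<in> {..<r} \<rightarrow>\<^sub>E N. \<not> (inj_on y {..<r} \<and> y ` {..<r} \<inter> B = {})}
    \<le> r * (card B + r) * card N ^ (r - 1)"
    (is "card ?bad \<le> _")
proof -
  let ?P = "{..<r} \<rightarrow>\<^sub>E N"
  let ?m = "card N ^ (r - 1)"
  have fin: "finite ?P" using assms by (simp add: finite_PiE)
  have "?bad \<subseteq> (\<Union>i<r. (\<Union>b\<in>B. {y \<in> ?P. y i = b}) \<union> (\<Union>j\<in>{..<r} - {i}. {y \<in> ?P. y i = y j}))"
    by (auto simp: inj_on_def)
  then have "card ?bad \<le> card (\<Union>i<r. (\<Union>b\<in>B. {y \<in> ?P. y i = b})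
      \<union> (\<Union>j\<in>{..<r} - {i}. {y \<in> ?P. y i = y j}))"
    by (rule card_mono[rotated]) (use fin assms in auto)
  also have "\<dots> \<le> (\<Sum>i<r. card ((\<Union>b\<in>B. {y \<in> ?P. y i = b})
      \<union> (\<Union>j\<in>{..<r} - {i}. {y \<in> ?P. y i = y j})))"
    by (rule card_UN_le) simp
  also have "\<dots> \<le> (\<Sum>i<r. (card B + r) * ?m)"
  proof (rule sum_mono)
    fix i assume i: "i \<in> {..<r}"
    have "card (\<Union>b\<in>B. {y \<in> ?P. y i = b}) \<le> (\<Sum>b\<in>B. card {y \<in> ?P. y i = b})"
      by (rule card_UN_le) fact
    also have "\<dots> \<le> (\<Sum>b\<in>B. ?m)"
    proof (rule sum_mono)
      fix b
      have "card {y \<in> ?P. y i = b} \<le> card N ^ (card {..<r} - 1)"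
        by (rule card_PiE_determined_le[where g = "\<lambda>_. b", OF _ assms(1) i]) auto
      then show "card {y \<in> ?P. y i = b} \<le> ?m" by simp
    qed
    finally have 1: "card (\<Union>b\<in>B. {y \<in> ?P. y i = b}) \<le> card B * ?m" by simp
    have "card (\<Union>j\<in>{..<r} - {i}. {y \<in> ?P. y i = y j})
        \<le> (\<Sum>j\<in>{..<r} - {i}. card {y \<in> ?P. y i = y j})"
      by (rule card_UN_le) simp
    also have "\<dots> \<le> (\<Sum>j\<in>{..<r} - {i}. ?m)"
    proof (rule sum_mono)
      \<comment> \<open>As \<open>j \<noteq> i\<close>, entry \<open>j\<close> survives the
        restriction to \<open>{..<r} - {i}\<close> and determines entry \<open>i\<close>.\<close>
      fix j assume "j \<in> {..<r} - {i}"
      then have "card {y \<in> ?P. y i = y j} \<le> card N ^ (card {..<r} - 1)"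
        by (intro card_PiE_determined_le[where g = "\<lambda>f. f j", OF _ assms(1) i]) simp_all
      then show "card {y \<in> ?P. y i = y j} \<le> ?m" by simp
    qed
    also have "\<dots> \<le> r * ?m" using i by (simp add: card_Diff_singleton)
    finally have 2: "card (\<Union>j\<in>{..<r} - {i}. {y \<in> ?P. y i = y j}) \<le> r * ?m" .
    show "card ((\<Union>b\<in>B. {y \<in> ?P. y i = b}) \<union> (\<Union>j\<in>{..<r} - {i}. {y \<in> ?P. y i = y j}))
        \<le> (card B + r) * ?m"
      using card_Un_le[of "\<Union>b\<in>B. {y \<in> ?P. y i = b}" "\<Union>j\<in>{..<r} - {i}. {y \<in> ?P. y i = y j}"] 1 2
      by (simp add: add_mult_distrib)
  qed
  finally show ?thesis by (simp add: mult.assoc)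
qed

section \<open>The auxiliary graph on tuples\<close>

definition common_nbrs :: "('v \<times> 'v) set \<Rightarrow> nat \<Rightarrow> (nat \<Rightarrow> 'v) \<Rightarrow> 'v set" where
  "common_nbrs E r x = {v. \<forall>i<r. (x i, v) \<in> E}"

text \<open>Adjacency in the auxiliary graph. Entries of a tuple may repeat; distinctness is
  restored only by the choices made in the embedding.\<close>

definition biclique :: "('v \<times> 'v) set \<Rightarrow> nat \<Rightarrow> (nat \<Rightarrow> 'v) \<Rightarrow> (nat \<Rightarrow> 'v) \<Rightarrow> bool" where
  "biclique E r x y \<longleftrightarrow> (\<forall>i<r. \<forall>j<r. (x i, y j) \<in> E)"

lemma symp_biclique: "sym E \<Longrightarrow> symp (biclique E r)"
  by (auto simp: symp_def biclique_def dest: symD)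

lemma common_nbrs_subset: "E \<subseteq> V \<times> V \<Longrightarrow> 0 < r \<Longrightarrow> common_nbrs E r x \<subseteq> V"
  by (auto simp: common_nbrs_def)

lemma biclique_nbrs_eq:
  assumes "E \<subseteq> V \<times> V" "0 < r"
  shows "{y \<in> {..<r} \<rightarrow>\<^sub>E V. biclique E r x y} = {..<r} \<rightarrow>\<^sub>E common_nbrs E r x"
  using common_nbrs_subset[OF assms, of x]
  by (simp add: set_eq_iff biclique_def common_nbrs_def PiE_iff) blast

text \<open>Double counting of pairs of a tuple \<open>x\<close> and a vertex \<open>v\<close>
  adjacent to all its entries: for fixed \<open>v\<close>, symmetry of \<open>E\<close> lets
  \<open>x\<close> be any tuple of neighbours of \<open>v\<close>.\<close>

lemma sum_card_common_nbrs:
  assumes "finite V" "E \<subseteq> V \<times> V" "sym E" "0 < r"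
  shows "(\<Sum>x\<in>{..<r} \<rightarrow>\<^sub>E V. card (common_nbrs E r x)) = (\<Sum>v\<in>V. card (E `` {v}) ^ r)"
proof -
  let ?A = "{..<r} \<rightarrow>\<^sub>E V"
  let ?P = "\<lambda>x v. \<forall>i<r. (x i, v) \<in> E"
  have fin: "finite ?A" using assms by (simp add: finite_PiE)
  have "(\<Sum>x\<in>?A. card (common_nbrs E r x)) = (\<Sum>x\<in>?A. \<Sum>v\<in>{v \<in> V. ?P x v}. 1)"
  proof (rule sum.cong)
    fix x
    have "common_nbrs E r x = {v \<in> V. ?P x v}"
      using common_nbrs_subset[OF assms(2,4)] by (auto simp: common_nbrs_def)
    then show "card (common_nbrs E r x) = (\<Sum>v\<in>{v \<in> V. ?P x v}. 1)" by simp
  qed simp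
  also have "\<dots> = (\<Sum>v\<in>V. \<Sum>x\<in>{x \<in> ?A. ?P x v}. 1)"
    by (rule sum.swap_restrict) (use fin assms in auto)
  also have "\<dots> = (\<Sum>v\<in>V. card (E `` {v}) ^ r)"
  proof (rule sum.cong)
    fix v
    have "{x \<in> ?A. ?P x v} = {..<r} \<rightarrow>\<^sub>E E `` {v}"
      using assms(2,3) by (simp add: set_eq_iff PiE_iff) (blast dest: symD)
    then show "(\<Sum>x\<in>{x \<in> ?A. ?P x v}. 1) = card (E `` {v}) ^ r" by (simp add: card_PiE)
  qed simp
  finally show ?thesis .
qed

text \<open>
  Summed over $d$ with mean at least $a$, this tangent-like bound replaces the power mean
  inequality.
\<close>

lemma power_diff_mult_mono:
  fixes a d :: real
  assumes "0 \<le> a" "0 \<le> d"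
  shows "a ^ k * (d - a) \<le> d ^ k * (d - a)"
proof (cases "a \<le> d")
  case True
  then show ?thesis using assms by (intro mult_right_mono power_mono) auto
next
  case False
  then show ?thesis using assms by (intro mult_right_mono_neg power_mono) auto
qed

text \<open>Prune with threshold \<open>M * d ^ (r - 1)\<close>, where \<open>d\<close> is the
  number of common neighbours of a tuple. This needs the sum of
  \<open>d ^ (r - 1) * (d - 2 * M)\<close> to be positive. By the tangent-like bound at
  \<open>2 * M\<close> it is at least \<open>(2 * M) ^ (r - 1)\<close> times the sum of
  \<open>d - 2 * M\<close>, which is positive by double counting and \<open>many\<close>.\<close>

lemma exists_biclique_core:
  assumes "finite V" "E \<subseteq> V \<times> V" "sym E" "0 < r" "0 < M"
    and many: "2 * M * card V ^ r < (\<Sum>v\<in>V. card (E `` {v}) ^ r)"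
  shows "\<exists>Y \<subseteq> {..<r} \<rightarrow>\<^sub>E V. Y \<noteq> {} \<and>
    (\<forall>x\<in>Y. M * card (common_nbrs E r x) ^ (r - 1) < card {y \<in> Y. biclique E r x y})"
proof (rule exists_subset_large_degrees)
  let ?A = "{..<r} \<rightarrow>\<^sub>E V"
  let ?d = "\<lambda>x. card (common_nbrs E r x)"
  show "finite ?A" using assms by (simp add: finite_PiE)
  show "symp (biclique E r)" using assms by (simp add: symp_biclique)
  obtain k where k: "r = Suc k" using assms(4) gr0_conv_Suc by auto
  have "2 * M * card ?A < (\<Sum>x\<in>?A. ?d x)"
    using many unfolding sum_card_common_nbrs[OF assms(1-4)] by (simp add: card_PiE)
  \<comment> \<open>Over the reals, since \<open>d - 2 * M\<close> may be negative for individual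
    tuples.\<close>
  then have "2 * real M * card ?A < (\<Sum>x\<in>?A. real (?d x))"
    unfolding of_nat_less_iff[where 'a = real, symmetric] by simp
  then have "0 < (2 * real M) ^ k * (\<Sum>x\<in>?A. real (?d x) - 2 * real M)"
    using \<open>0 < M\<close> by (intro mult_pos_pos) (auto simp: sum_subtractf mult_ac)
  also have "\<dots> = (\<Sum>x\<in>?A. (2 * real M) ^ k * (real (?d x) - 2 * real M))"
    by (simp add: sum_distrib_left)
  also have "\<dots> \<le> (\<Sum>x\<in>?A. real (?d x) ^ k * (real (?d x) - 2 * real M))"
    by (rule sum_mono, rule power_diff_mult_mono) simp_all
  also have "\<dots> = (\<Sum>x\<in>?A. real (?d x) ^ r - 2 * (M * real (?d x) ^ k))"
  proof (rule sum.cong)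
    fix x
    have "real (?d x) ^ r = real (?d x) ^ k * real (?d x)" by (simp add: k)
    then show "real (?d x) ^ k * (real (?d x) - 2 * real M) = real (?d x) ^ r - 2 * (M * real (?d x) ^ k)"
      by (simp add: right_diff_distrib)
  qed simp
  also have "\<dots> = (\<Sum>x\<in>?A. real (?d x) ^ r) - 2 * (\<Sum>x\<in>?A. M * real (?d x) ^ k)"
    by (simp only: sum_subtractf sum_distrib_left)
  finally have "real (2 * (\<Sum>x\<in>?A. M * ?d x ^ k)) < real (\<Sum>x\<in>?A. ?d x ^ r)"
    unfolding of_nat_mult of_nat_sum of_nat_power of_nat_numeral by linarith
  then have "2 * (\<Sum>x\<in>?A. M * ?d x ^ k) < (\<Sum>x\<in>?A. ?d x ^ r)"
    by (simp only: of_nat_less_iff)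
  then show "2 * (\<Sum>x\<in>?A. M * ?d x ^ (r - 1)) < (\<Sum>x\<in>?A. card {y \<in> ?A. biclique E r x y})"
    unfolding biclique_nbrs_eq[OF assms(2,4)] by (simp add: card_PiE k)
qed

section \<open>Growing and embedding a tree leaf by leaf\<close>

text \<open>Grow \<open>S\<close> from one vertex along arcs leaving it, which exist by
  connectedness. Two neighbours of the new vertex \<open>v\<close> in \<open>S\<close> would be
  joined by a path inside \<open>S\<close>, closing to a cycle through \<open>v\<close>. So
  \<open>v\<close> has a single neighbour in \<open>S\<close>, and extending an embedding to
  \<open>v\<close> has just one adjacency to respect.\<close>

lemma undirected_tree_induct [consumes 1, case_names root leaf]:
  assumes "undirected_tree T"
    and root: "\<And>u. u \<in> pverts T \<Longrightarrow> P {u}"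
    and leaf: "\<And>S u v. \<lbrakk>S \<subseteq> pverts T; u \<in> S; v \<in> pverts T - S; (u, v) \<in> parcs T;
      \<And>w. w \<in> S \<Longrightarrow> (w, v) \<in> parcs T \<Longrightarrow> w = u; P S\<rbrakk> \<Longrightarrow> P (insert v S)"
  shows "P (pverts T)"
proof -
  interpret T: pair_graph T using assms(1) by (simp add: undirected_tree_def)
  have conn: "strongly_connected (with_proj T)"
    using assms(1) by (intro T.symmetric_connected_imp_strongly_connected)
      (auto simp: undirected_tree_def T.pair_sym_arcs)
  have sym: "(b, a) \<in> parcs T" if "(a, b) \<in> parcs T" for a b
    using T.pair_sym_arcs that by (auto simp: symmetric_def sym_def)
  have acyc: "\<not> (T.cycle p \<and> 3 \<le> length p)" for p
    using assms(1) by (auto simp: undirected_tree_def)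
  \<comment> \<open>The invariant of the growth: the paths must stay inside \<open>S\<close>, so
    that one of them together with \<open>v\<close> is a genuine cycle.\<close>
  define lnk where "lnk S \<longleftrightarrow> (\<forall>u\<in>S. \<forall>w\<in>S. \<exists>p. T.apath u p w \<and> set (T.awalk_verts u p) \<subseteq> S)" for S
  have "\<exists>S \<subseteq> pverts T. card S = Suc k \<and> lnk S \<and> P S" if "Suc k \<le> card (pverts T)" for k
    using that
  proof (induction k)
    case 0
    then obtain u where u: "u \<in> pverts T" by fastforce
    have "T.apath u [] u" using u by (simp add: T.apath_Nil_iff)
    then show ?case using u root[OF u]
      by (intro exI[of _ "{u}"]) (auto simp: lnk_def intro!: exI[of _ "[]"])
  next
    case (Suc k)
    then obtain S where S: "S \<subseteq> pverts T" "card S = Suc k" "lnk S" "P S" by auto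
    have "\<exists>u\<in>S. \<exists>v. v \<notin> S \<and> (u, v) \<in> parcs T"
    proof (rule ccontr)
      \<comment> \<open>Everything reachable from a vertex of \<open>S\<close> would then stay in
        \<open>S\<close>, which is too small to be all of \<open>pverts T\<close>.\<close>
      assume none: "\<not> ?thesis"
      obtain u where u: "u \<in> S" using S(2) by fastforce
      have "pverts T \<subseteq> S"
      proof
        fix v assume "v \<in> pverts T"
        then have "u \<rightarrow>\<^sup>*\<^bsub>with_proj T\<^esub> v"
          using conn u S(1) by (auto simp: strongly_connected_def)
        then show "v \<in> S"
          by (induction rule: T.reachable_induct) (use u none in \<open>auto simp: with_proj_simps arcs_ends_conv\<close>)
      qed
      then show False using S Suc.prems by (metis Suc_n_not_le_n subset_antisym)
    qed
    then obtain u v where uv: "u \<in> S" "v \<notin> S" "(u, v) \<in> parcs T" by blast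
    then have v: "v \<in> pverts T" by (auto dest: T.wellformed')
    have "w = u" if w: "w \<in> S" "(w, v) \<in> parcs T" for w
    proof (rule ccontr)
      assume "w \<noteq> u"
      obtain p where p: "T.apath u p w" "set (T.awalk_verts u p) \<subseteq> S"
        using S(3) uv w unfolding lnk_def by blast
      \<comment> \<open>Needed for length at least 3: with \<open>p\<close> empty the closed walk
        would only go back and forth along one edge.\<close>
      have "p \<noteq> []" using p \<open>w \<noteq> u\<close> by (auto simp: T.apath_Nil_iff)
      have aw: "T.awalk u p w" "T.awlast u p = w" "distinct (T.awalk_verts u p)"
        using p(1) by (auto simp: T.apath_def)
      have pw: "T.awalk u (p @ [(w, v)]) v"
        using aw w v by (auto simp: T.awalk_simps)
      have "T.awalk_verts u (p @ [(w, v)]) = T.awalk_verts u p @ [v]"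
        using T.awalk_verts_append[OF pw] aw by simp
      then have "T.cycle ((v, u) # p @ [(w, v)])"
        unfolding T.cycle_def using pw aw p(2) uv sym[OF uv(3)]
        by (intro exI[of _ v]) (auto simp: T.awalk_Cons_iff)
      moreover have "3 \<le> length ((v, u) # p @ [(w, v)])"
        using \<open>p \<noteq> []\<close> by (cases p) auto
      ultimately show False using acyc by blast
    qed
    then have "P (insert v S)" using leaf[OF S(1) uv(1) _ uv(3)] S v uv by blast
    moreover have "lnk (insert v S)"
      unfolding lnk_def
    proof (intro ballI)
      fix a b assume ab: "a \<in> insert v S" "b \<in> insert v S"
      have vv: "T.apath v [] v" using v by (simp add: T.apath_Nil_iff)
      have to: "\<exists>p. T.apath a p v \<and> set (T.awalk_verts a p) \<subseteq> insert v S" if a: "a \<in> S"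
      proof -
        obtain p where p: "T.apath a p u" "set (T.awalk_verts a p) \<subseteq> S"
          using S(3) uv a unfolding lnk_def by blast
        then have aw: "T.awalk a p u" "T.awlast a p = u" by (auto simp: T.apath_def)
        have "T.apath a (p @ [(u, v)]) v"
          using p uv aw v T.wellformed'(1)[OF uv(3)] by (auto simp: T.apath_append_iff T.apath_simps)
        moreover have "set (T.awalk_verts a (p @ [(u, v)])) \<subseteq> insert v S"
          using T.awalk_verts_append[OF T.awalkI_apath[OF calculation]] aw p by auto
        ultimately show ?thesis by blast
      qed
      have "from": "\<exists>p. T.apath v p b \<and> set (T.awalk_verts v p) \<subseteq> insert v S" if b: "b \<in> S"
      proof -
        obtain p where p: "T.apath u p b" "set (T.awalk_verts u p) \<subseteq> S"
          using S(3) uv b unfolding lnk_def by blast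
        then show ?thesis using uv sym[OF uv(3)]
          by (intro exI[of _ "(v, u) # p"]) (auto simp: T.apath_simps)
      qed
      have "\<exists>p. T.apath v p v \<and> set (T.awalk_verts v p) \<subseteq> insert v S"
        using vv by (intro exI[of _ "[]"]) auto
      moreover have "\<exists>p. T.apath a p b \<and> set (T.awalk_verts a p) \<subseteq> insert v S" if "a \<in> S" "b \<in> S"
        using S(3) that unfolding lnk_def by blast
      ultimately show "\<exists>p. T.apath a p b \<and> set (T.awalk_verts a p) \<subseteq> insert v S"
        using ab to "from" by blast
    qed
    moreover have "card (insert v S) = Suc (Suc k)"
      using S uv by (metis card_insert_disjoint card_eq_0_iff nat.distinct(1))
    ultimately show ?case using S(1) v by (intro exI[of _ "insert v S"]) auto
  qed
  \<comment> \<open>A connected graph has a vertex, so \<open>Suc (card (pverts T) - 1)\<close> is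
    the full number of vertices.\<close>
  from this[of "card (pverts T) - 1"] obtain S where
    S: "S \<subseteq> pverts T" "card S = Suc (card (pverts T) - 1)" "P S"
    using conn T.pair_finite_verts
    by (auto simp: strongly_connected_def Suc_le_eq card_gt_0_iff)
  moreover have "S = pverts T"
    using S T.pair_finite_verts by (intro card_seteq) auto
  ultimately show ?thesis by simp
qed

text \<open>A leaf attached at \<open>u\<close> is sent to an injective tuple in \<open>Y\<close>
  related to \<open>\<phi> u\<close> and avoiding the at most \<open>r * card (pverts T)\<close>
  values already used. Injectivity on pairs says at once that each tuple is injective and that
  ranges are disjoint.\<close>

lemma embed_blowup_greedily:
  assumes "undirected_tree T" and "Y \<noteq> {}" and "symp R"
    and ext: "\<And>x B. \<lbrakk>x \<in> Y; finite B; card B \<le> r * card (pverts T)\<rbrakk> \<Longrightarrow>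
      \<exists>y\<in>Y. R x y \<and> inj_on y {..<r} \<and> y ` {..<r} \<inter> B = {}"
  shows "\<exists>\<phi>. \<phi> ` pverts T \<subseteq> Y \<and> inj_on (\<lambda>(u, i). \<phi> u i) (pverts T \<times> {..<r}) \<and>
    (\<forall>(u, v)\<in>parcs T. R (\<phi> u) (\<phi> v))"
proof -
  interpret T: pair_graph T using assms(1) by (simp add: undirected_tree_def)
  have sym: "(b, a) \<in> parcs T" if "(a, b) \<in> parcs T" for a b
    using T.pair_sym_arcs that by (auto simp: symmetric_def sym_def)
  have "\<exists>\<phi>. \<phi> ` pverts T \<subseteq> Y \<and> inj_on (\<lambda>(u, i). \<phi> u i) (pverts T \<times> {..<r}) \<and>
    (\<forall>u\<in>pverts T. \<forall>v\<in>pverts T. (u, v) \<in> parcs T \<longrightarrow> R (\<phi> u) (\<phi> v))"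
    using assms(1)
  proof (induction rule: undirected_tree_induct)
    case (root u)
    \<comment> \<open>Members of \<open>Y\<close> may have repeated entries, so the root is sent to
      a tuple supplied by \<open>ext\<close>, not to \<open>x\<close> itself.\<close>
    obtain x where "x \<in> Y" using assms(2) by blast
    from ext[OF this, of "{}"] obtain y where "y \<in> Y" "inj_on y {..<r}" by auto
    then show ?case
      by (intro exI[of _ "\<lambda>_. y"]) (auto simp: inj_on_def dest: T.pair_no_loops)
  next
    case (leaf S u v)
    then obtain \<phi> where \<phi>: "\<phi> ` S \<subseteq> Y" "inj_on (\<lambda>(u, i). \<phi> u i) (S \<times> {..<r})"
      "\<And>a b. \<lbrakk>a \<in> S; b \<in> S; (a, b) \<in> parcs T\<rbrakk> \<Longrightarrow> R (\<phi> a) (\<phi> b)" by blast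
    define B where "B = (\<lambda>(u, i). \<phi> u i) ` (S \<times> {..<r})"
    have fin: "finite S" using leaf T.pair_finite_verts finite_subset by blast
    have "card B \<le> card (S \<times> {..<r})"
      unfolding B_def by (rule card_image_le) (use fin in auto)
    also have "\<dots> \<le> r * card (pverts T)"
      using card_mono[OF T.pair_finite_verts leaf(1)] by (simp add: card_cartesian_product)
    finally obtain y where y: "y \<in> Y" "R (\<phi> u) y" "inj_on y {..<r}" "y ` {..<r} \<inter> B = {}"
      using ext[of "\<phi> u" B] leaf \<phi> fin unfolding B_def by blast
    have new: "y i \<noteq> \<phi> a j" "\<phi> a j \<noteq> y i" if "a \<in> S" "i < r" "j < r" for a i j
      using y(4) that unfolding B_def by fastforce+
    have inj: "inj_on (\<lambda>(a, i). (\<phi>(v := y)) a i) (insert v S \<times> {..<r})"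
    proof (rule inj_onI)
      fix p q
      assume p: "p \<in> insert v S \<times> {..<r}" and q: "q \<in> insert v S \<times> {..<r}"
        and eq: "(case p of (a, i) \<Rightarrow> (\<phi>(v := y)) a i) = (case q of (a, i) \<Rightarrow> (\<phi>(v := y)) a i)"
      obtain a i b j where [simp]: "p = (a, i)" "q = (b, j)" by (cases p, cases q)
      show "p = q"
        using p q eq new y(3) inj_onD[OF \<phi>(2), of "(a, i)" "(b, j)"] leaf(3)
        by (auto simp: inj_on_def split: if_splits)
    qed
    have "R ((\<phi>(v := y)) a) ((\<phi>(v := y)) b)"
      if "a \<in> insert v S" "b \<in> insert v S" "(a, b) \<in> parcs T" for a b
    proof -
      have "\<not> (a = v \<and> b = v)" using that T.pair_no_loops by fastforce
      moreover have "R y (\<phi> b)" if "b \<in> S" "(v, b) \<in> parcs T"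
        using leaf(5)[of b] that sym y(2) assms(3) by (auto dest: sympD)
      moreover have "R (\<phi> a) y" if "a \<in> S" "(a, v) \<in> parcs T"
        using leaf(5)[of a] that y(2) by auto
      ultimately show ?thesis using that \<phi>(3) leaf(3) by auto
    qed
    then show ?case using inj \<phi>(1) y(1) by (intro exI[of _ "\<phi>(v := y)"]) auto
  qed
  then show ?thesis by (fast dest: T.wellformed')
qed

section \<open>The edge bound\<close>

text \<open>The constant \<open>r * (r * card (pverts T) + r)\<close> comes from the count of bad
  tuples when at most \<open>r * card (pverts T)\<close> vertices are forbidden. A tuple of the core
  has more neighbours in the core than there are bad ones, so some neighbour is injective and avoids
  the forbidden set, as the greedy embedding demands.\<close>

lemma contains_blowup_if_many_stars:
  assumes "pair_graph G" "undirected_tree T" "0 < r"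
    and many: "2 * (r * (r * card (pverts T) + r)) * card (pverts G) ^ r
      < (\<Sum>v\<in>pverts G. card (parcs G `` {v}) ^ r)"
  shows "contains_copy G (blowup T r)"
proof -
  interpret G: pair_graph G by fact
  let ?V = "pverts G" and ?E = "parcs G"
  let ?M = "r * (r * card (pverts T) + r)"
  have T: "pair_graph T" using assms(2) by (simp add: undirected_tree_def)
  have E: "finite ?V" "?E \<subseteq> ?V \<times> ?V" "sym ?E"
    using G.pair_finite_verts G.pair_sym_arcs by (auto simp: symmetric_def dest: G.wellformed')
  obtain Y where Y: "Y \<subseteq> {..<r} \<rightarrow>\<^sub>E ?V" "Y \<noteq> {}"
    and deg: "\<And>x. x \<in> Y \<Longrightarrow>
      ?M * card (common_nbrs ?E r x) ^ (r - 1) < card {y \<in> Y. biclique ?E r x y}"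
    using exists_biclique_core[OF E assms(3) _ many] assms(3) by auto
  have "\<exists>y\<in>Y. biclique ?E r x y \<and> inj_on y {..<r} \<and> y ` {..<r} \<inter> B = {}"
    if x: "x \<in> Y" and B: "finite B" "card B \<le> r * card (pverts T)" for x B
  proof (rule ccontr)
    assume none: "\<not> ?thesis"
    let ?N = "common_nbrs ?E r x"
    let ?bad = "{y \<in> {..<r} \<rightarrow>\<^sub>E ?N. \<not> (inj_on y {..<r} \<and> y ` {..<r} \<inter> B = {})}"
    have N: "finite ?N" using common_nbrs_subset[OF E(2) assms(3)] E(1) by (rule finite_subset)
    have "{y \<in> Y. biclique ?E r x y} \<subseteq> ?bad"
      using none Y(1) biclique_nbrs_eq[OF E(2) assms(3), of x] by blast
    then have "card {y \<in> Y. biclique ?E r x y} \<le> card ?bad"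
      by (rule card_mono[rotated]) (use N in \<open>simp add: finite_PiE\<close>)
    also have "\<dots> \<le> r * (card B + r) * card ?N ^ (r - 1)"
      by (rule card_PiE_noninj_or_hitting_le) (use N B in auto)
    also have "\<dots> \<le> ?M * card ?N ^ (r - 1)"
      using B by (intro mult_right_mono mult_left_mono) auto
    finally show False using deg[OF x] by simp
  qed
  from embed_blowup_greedily[OF assms(2) Y(2) symp_biclique[OF E(3)] this]
  obtain \<phi> where \<phi>: "\<phi> ` pverts T \<subseteq> Y" "inj_on (\<lambda>(u, i). \<phi> u i) (pverts T \<times> {..<r})"
    "\<forall>(u, v)\<in>parcs T. biclique ?E r (\<phi> u) (\<phi> v)" by blast
  have "(\<lambda>(u, i). \<phi> u i) ` (pverts T \<times> {..<r}) \<subseteq> ?V"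
    using \<phi>(1) Y(1) by (fastforce simp: PiE_iff subset_iff)
  then show ?thesis
    unfolding contains_copy_iff[OF pair_graph_blowup[OF T] assms(1)] using \<phi>(2,3)
    by (intro exI[of _ "\<lambda>(u, i). \<phi> u i"]) (auto simp: blowup_def biclique_def)
qed

text \<open>A crude power mean inequality, losing a factor \<open>2 ^ r\<close>: each
  \<open>f v ^ r\<close> is at least \<open>a ^ (r - 1) * (f v - a)\<close>, and the differences
  \<open>f v - a\<close> sum to at least \<open>a * card V\<close>.\<close>

lemma power_sum_lower_bound:
  fixes f :: "'v \<Rightarrow> nat" and a :: real
  assumes "0 \<le> a" "0 < r" "2 * a * card V \<le> real (sum f V)"
  shows "a ^ r * card V \<le> real (\<Sum>v\<in>V. f v ^ r)"
proof -
  obtain k where k: "r = Suc k" using assms(2) gr0_conv_Suc by auto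
  have "a ^ r * card V = a ^ k * (a * card V)" by (simp add: k mult_ac)
  also have "\<dots> \<le> a ^ k * (real (sum f V) - a * card V)"
    using assms(1,3) by (intro mult_left_mono) auto
  also have "\<dots> = (\<Sum>v\<in>V. a ^ k * (real (f v) - a))"
    unfolding sum_distrib_left[symmetric] by (simp add: sum_subtractf mult.commute)
  also have "\<dots> \<le> (\<Sum>v\<in>V. real (f v) ^ r)"
  proof (rule sum_mono)
    fix v
    have "a ^ k * (real (f v) - a) \<le> real (f v) ^ k * (real (f v) - a)"
      using assms(1) by (intro power_diff_mult_mono) auto
    also have "\<dots> \<le> real (f v) ^ k * real (f v)" using assms(1) by (intro mult_left_mono) auto
    finally show "a ^ k * (real (f v) - a) \<le> real (f v) ^ r" by (simp add: k mult.commute)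
  qed
  finally show ?thesis by simp
qed

lemma card_uedges_free_le:
  assumes "pair_graph G" "undirected_tree T" "0 < r" "\<not> contains_copy G (blowup T r)"
  shows "real (card (uedges G))
    \<le> (6 * real (r * (r * card (pverts T) + r))) * real (card (pverts G)) powr (2 - 1 / real r)"
proof (rule ccontr)
  interpret G: pair_graph G by fact
  let ?M = "r * (r * card (pverts T) + r)"
  let ?V = "pverts G" and ?E = "parcs G"
  define n where "n = real (card ?V)"
  \<comment> \<open>Chosen so that \<open>2 * a * n\<close> is the claimed edge bound; the factor 3
    keeps \<open>(3 * ?M) ^ r\<close> above \<open>2 * ?M\<close> even for
    \<open>r = 1\<close>.\<close>
  define a where "a = 3 * real ?M * n powr (1 - 1 / r)"
  assume "\<not> ?thesis"
  then have large: "6 * real ?M * n powr (2 - 1 / real r) < card (uedges G)"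
    by (simp add: n_def)
  \<comment> \<open>The exponent laws below need \<open>n > 0\<close>; for \<open>n = 0\<close> both
    sides of the bound vanish, because \<open>0 powr x = 0\<close>.\<close>
  have "n \<noteq> 0"
  proof
    assume "n = 0"
    then have "card (uedges G) = 0" using card_uedges_le[OF assms(1)] by (simp add: n_def)
    then show False using large \<open>n = 0\<close> by simp
  qed
  moreover have "0 \<le> n" by (simp add: n_def)
  ultimately have n: "n > 0" by simp
  have "1 \<le> ?M" using assms(3) by simp
  then have "real 1 \<le> real ?M" by (rule of_nat_mono)
  then have M: "1 \<le> real ?M" by (simp only: of_nat_1)
  have "n powr (1 - 1 / r) * n = n powr (1 - 1 / r + 1)"
    using n unfolding powr_add by simp
  also have "1 - 1 / r + 1 = 2 - 1 / real r" by simp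
  finally have "2 * a * n = 6 * real ?M * n powr (2 - 1 / real r)"
    by (simp only: a_def mult.assoc)
  also have "\<dots> \<le> card (uedges G)" using large by simp
  \<comment> \<open>The factor 2 between edges and arcs is given away.\<close>
  also have "\<dots> \<le> card ?E"
    unfolding uedges_def using card_image_le[OF G.pair_finite_arcs] by (simp add: case_prod_beta)
  also have "card ?E = (\<Sum>v\<in>?V. card (?E `` {v}))"
  proof -
    have "?E = Sigma ?V (\<lambda>v. ?E `` {v})" by (auto dest: G.wellformed')
    moreover have "finite (?E `` {v})" for v
      using G.pair_finite_arcs by (simp add: finite_Image)
    ultimately show ?thesis using G.pair_finite_verts card_SigmaI[of ?V "\<lambda>v. ?E `` {v}"] by simp
  qed
  finally have "a ^ r * n \<le> real (\<Sum>v\<in>?V. card (?E `` {v}) ^ r)"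
    unfolding n_def by (intro power_sum_lower_bound) (use assms(3) in \<open>auto simp: a_def\<close>)
  moreover have "(\<Sum>v\<in>?V. card (?E `` {v}) ^ r) \<le> 2 * ?M * card ?V ^ r"
    using contains_blowup_if_many_stars[OF assms(1-3)] assms(4) not_less by blast
  then have "real (\<Sum>v\<in>?V. card (?E `` {v}) ^ r) \<le> real (2 * ?M * card ?V ^ r)"
    by (rule of_nat_mono)
  then have "real (\<Sum>v\<in>?V. card (?E `` {v}) ^ r) \<le> 2 * real ?M * n ^ r"
    by (simp only: of_nat_mult of_nat_power of_nat_numeral n_def)
  \<comment> \<open>The exponent \<open>1 - 1 / r\<close> in \<open>a\<close> is the one for which
    \<open>(1 - 1 / r) * r + 1 = r\<close>, matching the \<open>n ^ r\<close> of the upper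
    bound.\<close>
  moreover have "a ^ r * n = (3 * real ?M) ^ r * n ^ r"
  proof -
    have "(n powr (1 - 1 / r)) ^ r = n powr ((1 - 1 / r) * r)"
      using powr_realpow[of "n powr (1 - 1 / r)" r] n unfolding powr_powr by simp
    then have "(n powr (1 - 1 / r)) ^ r * n = n powr ((1 - 1 / r) * r + 1)"
      using n unfolding powr_add by simp
    also have "(1 - 1 / r) * r + 1 = real r" using assms(3) by (simp add: field_simps)
    also have "n powr real r = n ^ r" using n by (rule powr_realpow)
    finally show ?thesis by (simp only: a_def power_mult_distrib mult.assoc)
  qed
  ultimately have "(3 * real ?M) ^ r * n ^ r \<le> 2 * real ?M * n ^ r" by linarith
  then have "(3 * real ?M) ^ r \<le> 2 * real ?M" using n by simp
  moreover have "3 * real ?M \<le> (3 * real ?M) ^ r"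
  proof (rule self_le_power)
    show "1 \<le> 3 * real ?M" using M by linarith
  qed fact
  ultimately show False using M by linarith
qed

theorem theorem1p6:
  fixes T :: "'a pair_pre_digraph" and r :: nat
  assumes "r \<ge> 1" and "undirected_tree T"
  shows "\<exists>C :: real. \<forall>n :: nat.
    real (ex_number n (blowup T r)) \<le> C * real n powr (2 - 1 / real r)"
proof (intro exI allI)
  fix n
  let ?C = "6 * real (r * (r * card (pverts T) + r))"
  let ?X = "{card (uedges G) | G :: nat pair_pre_digraph.
     pair_graph G \<and> card (pverts G) = n \<and> \<not> contains_copy G (blowup T r)}"
  show "real (ex_number n (blowup T r)) \<le> ?C * real n powr (2 - 1 / real r)"
  proof (cases "?X = {}")
    \<comment> \<open>Without admissible graphs, \<open>Sup\<close> of the empty set is 0 and the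
      right-hand side is nonnegative.\<close>
    case True
    then show ?thesis by (simp add: ex_number_def del: Collect_empty_eq empty_Collect_eq)
  next
    \<comment> \<open>The set of edge counts is finite and nonempty, so the supremum is attained by
      a graph to which the edge bound applies.\<close>
    case False
    then have "ex_number n (blowup T r) \<in> ?X"
      unfolding ex_number_def using finite_free_edge_counts[of n "blowup T r"]
      by (metis (lifting) Max_in cSup_eq_Max)
    then show ?thesis using card_uedges_free_le[OF _ assms(2)] assms(1) by force
  qed
qed

end
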